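(* Let $\lambda>0$ and $\pi\in\mathcal{M}$. Assume that for any $z\in\mathcal{Z}$ and $g\in\mathcal{G}$, we have $a\le L(z,g)\le b$ for some reals $a,b$. Consider the SeqRand algorithm applied with $\delta_\lambda(Z,g,g')=\lambda(b-a)^2/8$ and $\hat\pi(\rho)=\rho$. Its expected risk $\mathbb{E}_{Z_1^n}\mathbb{E}_{g\sim\hat\mu}R(g)$, where $\hat\mu$ denotes the randomizing distribution, satisfies $$\mathbb{E}_{Z_1^n}\mathbb{E}_{g\sim\hat\mu}R(g)\le\min_{\rho\in\mathcal{M}}\left\{\mathbb{E}_{g\sim\rho}R(g)+\frac{\lambda(b-a)^2}{8}+\frac{K(\rho,\pi)}{\lambda(n+1)}\right\}.$$ In particular, when $\mathcal{G}$ is finite, by taking $\pi$ uniform on $\mathcal{G}$ and $\lambda=\sqrt{\frac{8\log|\mathcal{G}|}{(b-a)^2(n+1)}}$, we get $$\mathbb{E}_{Z_1^n}\mathbb{E}_{g\sim\hat\mu}R(g)-\min_{g\in\mathcal{G}}R(g)\le(b-a)\sqrt{\frac{\log|\mathcal{G}|}{2(n+1)}}.$$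
   Context: Setting. $\mathcal{Z}=\mathcal{X}\times\mathcal{Y}$; the training set $Z_1^n=(Z_1,\dots,Z_n)$ consists of $n$ independent random variables with the same unknown distribution $P$ on $\mathcal{Z}$. Prediction functions are measurable functions $\mathcal{X}\to\mathcal{Y}$; $\mathcal{G}$ is a measurable space of prediction functions and $\mathcal{M}$ is the set of probability distributions on $\mathcal{G}$. $L(z,g)\in\mathbb{R}$ is the loss of the prediction function $g$ on $z$ (not assumed convex) and $R(g)=\mathbb{E}_{Z\sim P}L(Z,g)$. All manipulated quantities are implicitly assumed measurable. Notation. For a measurable $h:\mathcal{G}\to\mathbb{R}$, $\pi_{-h}(dg)=\frac{e^{-h(g)}}{\mathbb{E}_{g'\sim\pi}e^{-h(g')}}\,\pi(dg)$. $K(\rho,\pi)$ is the Kullback–Leibler divergence ($+\infty$ if $\rho\not\ll\pi$). SeqRand algorithm for this choice of $\delta_\lambda$ and $\hat\pi$. (1) Draw $\hat g_0$ according to $\pi$ and set $S_0\equiv0$. (2) For $i=1,\dots,n$, let $S_i(g)=S_{i-1}(g)+L(Z_i,g)+\lambda(b-a)^2/8$ for all $g\in\mathcal{G}$ and draw $\hat g_i$ according to $\pi_{-\lambda S_i}$. (3) Predict with a function drawn uniformly from $\{\hat g_0,\dots,\hat g_n\}$. The randomizing distribution $\hat\mu$ is the distribution of the output prediction function conditionally on the training set $Z_1^n$. *)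

theory Defs
  imports "HOL-Probability.Probability"
begin

definition risk :: "'z measure \<Rightarrow> ('z \<Rightarrow> 'g \<Rightarrow> real) \<Rightarrow> 'g \<Rightarrow> real"
  where "risk P L g = (\<integral>z. L z g \<partial>P)"

text \<open>The distribution \<open>\<pi>\<^bsub>-h\<^esub>\<close>.\<close>

definition gibbs :: "'g measure \<Rightarrow> ('g \<Rightarrow> real) \<Rightarrow> 'g measure"
  where "gibbs \<pi> h = density \<pi> (\<lambda>g. ennreal (exp (- h g) / (\<integral>g'. exp (- h g') \<partial>\<pi>)))"

text \<open>
  Extended-valued Kullback--Leibler divergence \<open>K(\<rho>, \<pi>)\<close> of probability measures (note the
  reversed argument order in the library's real-valued \<open>KL_divergence\<close>, which integrates
  \<open>log (d\<rho>/d\<pi>)\<close> against \<open>\<rho>\<close>). The negative part of \<open>ln (d\<rho>/d\<pi>)\<close> is always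
  \<open>\<rho>\<close>-integrable, so if the integral does not exist its value is \<open>\<infinity>\<close>.
\<close>

definition KL :: "'g measure \<Rightarrow> 'g measure \<Rightarrow> ereal"
  where "KL \<rho> \<pi> =
    (if absolutely_continuous \<pi> \<rho> \<and> integrable \<rho> (entropy_density (exp 1) \<pi> \<rho>)
     then ereal (KL_divergence (exp 1) \<pi> \<rho>) else \<infinity>)"

text \<open>
  SeqRand with general parameters: \<open>\<delta>\<close> stands for \<open>\<delta>\<^sub>\<lambda>\<close>, \<open>pihat\<close> for the map
  \<open>\<rho> \<mapsto> pihat(\<rho>)\<close> on distributions and \<open>lam\<close> for \<open>\<lambda>\<close>. The training sample
  \<open>Z\<^sub>1, \<dots>, Z\<^sub>n\<close> is \<open>z 1, \<dots>, z n\<close> (\<open>z 0\<close> is never used) and the drawn functions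
  \<open>g\<^sub>0, \<dots>, g\<^sub>n\<close> are \<open>gs 0, \<dots>, gs n\<close>. At step \<open>i\<close>,
  \<open>S\<^sub>i(g) = S\<^sub>i\<^sub>-\<^sub>1(g) + L(Z\<^sub>i, g) + \<delta>\<^sub>\<lambda>(Z\<^sub>i, g, g\<^sub>i\<^sub>-\<^sub>1)\<close> and \<open>g\<^sub>i\<close> is drawn from
  \<open>pihat(\<pi>\<^bsub>-\<lambda>S\<^sub>i\<^esub>)\<close>; for constant \<open>\<delta>\<close> the score does not depend on earlier draws.
\<close>

primrec seqrand_score ::
  "('z \<Rightarrow> 'g \<Rightarrow> real) \<Rightarrow> ('z \<Rightarrow> 'g \<Rightarrow> 'g \<Rightarrow> real) \<Rightarrow> (nat \<Rightarrow> 'z) \<Rightarrow> (nat \<Rightarrow> 'g)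
    \<Rightarrow> nat \<Rightarrow> 'g \<Rightarrow> real"
  where
    "seqrand_score L \<delta> z gs 0 g = 0"
  | "seqrand_score L \<delta> z gs (Suc i) g =
       seqrand_score L \<delta> z gs i g + L (z (Suc i)) g + \<delta> (z (Suc i)) g (gs i)"

text \<open>Joint law of \<open>(g\<^sub>0, \<dots>, g\<^sub>i)\<close> given the sample \<open>z\<close>.\<close>

primrec seqrand_draws ::
  "'g measure \<Rightarrow> ('z \<Rightarrow> 'g \<Rightarrow> real) \<Rightarrow> real \<Rightarrow> ('z \<Rightarrow> 'g \<Rightarrow> 'g \<Rightarrow> real)
    \<Rightarrow> ('g measure \<Rightarrow> 'g measure) \<Rightarrow> 'g measure \<Rightarrow> (nat \<Rightarrow> 'z) \<Rightarrow> nat \<Rightarrow> (nat \<Rightarrow> 'g) measure"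
  where
    "seqrand_draws G L lam \<delta> pihat \<pi> z 0 =
       distr (pihat \<pi>) (PiM {..0} (\<lambda>_. G)) (\<lambda>g. \<lambda>j\<in>{..0}. g)"
  | "seqrand_draws G L lam \<delta> pihat \<pi> z (Suc i) =
       seqrand_draws G L lam \<delta> pihat \<pi> z i \<bind>
         (\<lambda>gs. distr (pihat (gibbs \<pi> (\<lambda>g. lam * seqrand_score L \<delta> z gs (Suc i) g)))
                 (PiM {..Suc i} (\<lambda>_. G)) (\<lambda>g. gs(Suc i := g)))"

text \<open>
  The randomizing distribution: conditional law of the output \<open>gs k\<close> given the sample, where the
  index \<open>k\<close> is uniform on \<open>{0, \<dots>, n}\<close> (so repeated draws count with multiplicity).
\<close>

definition seqrand ::
  "'g measure \<Rightarrow> ('z \<Rightarrow> 'g \<Rightarrow> real) \<Rightarrow> real \<Rightarrow> ('z \<Rightarrow> 'g \<Rightarrow> 'g \<Rightarrow> real)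
    \<Rightarrow> ('g measure \<Rightarrow> 'g measure) \<Rightarrow> 'g measure \<Rightarrow> nat \<Rightarrow> (nat \<Rightarrow> 'z) \<Rightarrow> 'g measure"
  where "seqrand G L lam \<delta> pihat \<pi> n z =
    seqrand_draws G L lam \<delta> pihat \<pi> z n \<bind> (\<lambda>gs. distr (uniform_count_measure {..n}) G gs)"

text \<open>
  Uniform distribution on the finite space \<open>G\<close>; as a measure on the \<open>\<sigma>\<close>-algebra of \<open>G\<close>,
  which need not be the power set.
\<close>

definition uniform_on :: "'g measure \<Rightarrow> 'g measure"
  where "uniform_on G = distr (uniform_count_measure (space G)) G (\<lambda>g. g)"

end

theory Submission
  imports Defs
begin

text \<open>
  Since \<open>\<delta>\<close> is constant and \<open>pihat\<close> is the identity, the draws are independent given the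
  sample and \<open>g\<^sub>k\<close> follows the Gibbs posterior of the first \<open>k\<close> losses. Let \<open>W\<^sub>k\<close> be its
  normalising constant. Hoeffding's lemma applied under this posterior bounds the mean loss on a fresh
  observation \<open>Z\<^sub>k\<^sub>+\<^sub>1\<close> by \<open>\<lambda>(b - a)\<^sup>2 / 8 - (ln W\<^sub>k\<^sub>+\<^sub>1 - ln W\<^sub>k) / \<lambda>\<close>. In
  expectation the left-hand side is the risk of the \<open>k\<close>-th draw, so summing over \<open>k \<le> n\<close>
  telescopes to \<open>- E ln W\<^sub>n\<^sub>+\<^sub>1 / \<lambda>\<close>. By the Gibbs variational formula this is at most
  \<open>- ln (\<integral> exp (- \<lambda>(n + 1) R) d\<pi>) / \<lambda>\<close>, and the same formula shows that this plus \<open>\<lambda>(n + 1)(b - a)\<^sup>2 / 8\<close> is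
  \<open>n + 1\<close> times the minimum over \<open>\<rho>\<close>, attained at the Gibbs measure of \<open>\<lambda>(n + 1) R\<close>.
\<close>

subsection \<open>Gibbs measures and the variational formula\<close>

context prob_space
begin

lemma integral_exp_bounded:
  assumes [measurable]: "h \<in> borel_measurable M" and h: "\<And>x. x \<in> space M \<Longrightarrow> \<bar>h x :: real\<bar> \<le> B"
  shows "integrable M (\<lambda>x. exp (- h x))" and "0 < expectation (\<lambda>x. exp (- h x))"
proof -
  show int: "integrable M (\<lambda>x. exp (- h x))"
    by (rule integrable_const_bound[of _ "exp B"]) (use h in \<open>auto intro!: AE_I2 simp: abs_le_iff\<close>)
  have "exp (- B) \<le> expectation (\<lambda>x. exp (- h x))"
    by (rule integral_ge_const[OF int]) (use h in \<open>auto intro!: AE_I2 simp: abs_le_iff\<close>)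
  then show "0 < expectation (\<lambda>x. exp (- h x))"
    by (rule less_le_trans[rotated]) simp
qed

lemma integral_gibbs:
  assumes [measurable]: "h \<in> borel_measurable M" and h: "\<And>x. x \<in> space M \<Longrightarrow> \<bar>h x :: real\<bar> \<le> B"
    and [measurable]: "f \<in> borel_measurable M"
  shows "(\<integral>x. f x \<partial>gibbs M h) = (\<integral>x. f x * exp (- h x) \<partial>M) / (\<integral>x. exp (- h x) \<partial>M)"
proof -
  note pos = integral_exp_bounded[OF assms(1) h]
  show ?thesis
    unfolding gibbs_def using pos
    by (subst integral_density) (auto intro!: AE_I2 simp: mult.commute)
qed

lemma prob_space_gibbs:
  assumes [measurable]: "h \<in> borel_measurable M" and h: "\<And>x. x \<in> space M \<Longrightarrow> \<bar>h x :: real\<bar> \<le> B"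
  shows "prob_space (gibbs M h)"
proof
  note pos = integral_exp_bounded[OF assms(1) h]
  have "emeasure (gibbs M h) (space (gibbs M h)) =
      (\<integral>\<^sup>+x. ennreal (exp (- h x) / expectation (\<lambda>x. exp (- h x))) \<partial>M)"
    by (simp add: gibbs_def emeasure_density cong: nn_integral_cong)
  also have "\<dots> = ennreal (\<integral>x. exp (- h x) / expectation (\<lambda>x. exp (- h x)) \<partial>M)"
    using pos by (intro nn_integral_eq_integral) auto
  also have "\<dots> = 1"
    using pos(2) by simp
  finally show "emeasure (gibbs M h) (space (gibbs M h)) = 1" .
qed

text \<open>The factor \<open>exp (- c)\<close> occurs both in the numerator and in the normalising
  integral, and cancels. This is why constant score increments leave no trace in the
  posterior.\<close>

lemma gibbs_add_const: "gibbs M (\<lambda>x. h x + c) = gibbs M h"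
proof -
  have "exp (- (h x + c)) = exp (- c) * exp (- h x)" for x
    by (simp flip: exp_add)
  then show ?thesis
    by (simp add: gibbs_def)
qed

text \<open>The variable \<open>- f\<close> ranges over an interval of length \<open>b - a\<close>,
  so its centred exponential moment at \<open>l\<close> is at most
  \<open>exp (l\<^sup>2 * (b - a)\<^sup>2 / 8)\<close>. Factoring out
  \<open>exp (l * expectation f)\<close>, taking logarithms and dividing by \<open>l\<close> gives
  this form.\<close>

lemma Hoeffdings_lemma_ln:
  assumes [measurable]: "f \<in> borel_measurable M" and f: "\<And>x. x \<in> space M \<Longrightarrow> f x \<in> {a..b::real}" and "l > 0"
  shows "expectation f \<le> l * (b - a)\<^sup>2 / 8 - ln (expectation (\<lambda>x. exp (- (l * f x)))) / l"
proof -
  interpret interval_bounded_random_variable M "\<lambda>x. - f x" "- b" "- a"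
    by unfold_locales (use f in auto)
  have "\<bar>f x\<bar> \<le> max \<bar>a\<bar> \<bar>b\<bar>" if "x \<in> space M" for x
    using f[OF that] by auto
  then have bd: "\<bar>l * f x\<bar> \<le> l * max \<bar>a\<bar> \<bar>b\<bar>" if "x \<in> space M" for x
    using that \<open>l > 0\<close> by (simp add: abs_mult)
  have pos: "integrable M (\<lambda>x. exp (- (l * f x)))" "0 < expectation (\<lambda>x. exp (- (l * f x)))"
    using integral_exp_bounded[of "\<lambda>x. l * f x", OF _ bd] by auto
  have split: "exp (l * (- f x - expectation (\<lambda>x. - f x))) = exp (l * expectation f) * exp (- (l * f x))" for x
    by (simp add: algebra_simps flip: exp_add)
  have "ennreal (expectation (\<lambda>x. exp (l * expectation f) * exp (- (l * f x))))
      = (\<integral>\<^sup>+x. ennreal (exp (l * (- f x - expectation (\<lambda>x. - f x)))) \<partial>M)"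
    unfolding split by (rule nn_integral_eq_integral[symmetric]) (use pos in auto)
  also have "\<dots> \<le> ennreal (exp (l\<^sup>2 * (- a - - b)\<^sup>2 / 8))"
    by (rule Hoeffdings_lemma_nn_integral) fact
  finally have "exp (l * expectation f) * expectation (\<lambda>x. exp (- (l * f x)))
      \<le> exp (l\<^sup>2 * (b - a)\<^sup>2 / 8)"
    using pos by (subst (asm) ennreal_le_iff) auto
  then have "ln (exp (l * expectation f) * expectation (\<lambda>x. exp (- (l * f x)))) \<le> l\<^sup>2 * (b - a)\<^sup>2 / 8"
    using pos(2) by (subst ln_exp[symmetric], subst ln_le_cancel_iff) auto
  then have "l * expectation f + ln (expectation (\<lambda>x. exp (- (l * f x)))) \<le> l\<^sup>2 * (b - a)\<^sup>2 / 8"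
    using pos(2) by (simp add: ln_mult_pos)
  then show ?thesis
    using \<open>l > 0\<close> by (simp add: field_simps power2_eq_square)
qed

text \<open>The inequality half of the Gibbs variational formula. The ratio \<open>u\<close> of the
  Gibbs density to the density \<open>f\<close> of \<open>N\<close> has \<open>N\<close>-integral at
  most 1, and integrating \<open>ln u \<le> u - 1\<close> under \<open>N\<close> gives the
  claim.\<close>

lemma ln_integral_exp_le:
  assumes N: "prob_space N" "sets N = sets M" "absolutely_continuous M N"
    and int: "integrable N (entropy_density (exp 1) M N)"
    and [measurable]: "h \<in> borel_measurable M" and h: "\<And>x. x \<in> space M \<Longrightarrow> \<bar>h x :: real\<bar> \<le> B"
  shows "- ln (expectation (\<lambda>x. exp (- h x))) \<le> (\<integral>x. h x \<partial>N) + KL_divergence (exp 1) M N"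
proof -
  interpret N: prob_space N by fact
  note [measurable_cong] = N(2)
  define f where "f x = enn2real (RN_deriv M N x)" for x
  define C where "C = expectation (\<lambda>x. exp (- h x))"
  have C: "0 < C"
    unfolding C_def by (rule integral_exp_bounded(2)[OF _ h]) auto
  have f0: "f x \<ge> 0" for x
    by (simp add: f_def)
  have [measurable]: "f \<in> borel_measurable M"
    unfolding f_def by measurable
  \<comment> \<open>The derivative takes extended values; it is finite almost everywhere because
    \<open>N\<close> is finite, so its real version \<open>f\<close> is still a density.\<close>
  have "AE x in M. RN_deriv M N x \<noteq> \<infinity>"
    by (rule RN_deriv_finite) (use N N.sigma_finite_measure_axioms in auto)
  then have N_eq: "N = density M (\<lambda>x. ennreal (f x))"
    by (subst density_RN_deriv[OF N(3,2), symmetric])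
      (auto intro!: density_cong simp: f_def less_top)
  have ent: "entropy_density (exp 1) M N = (\<lambda>x. ln (f x))"
    by (simp add: entropy_density_def f_def log_def fun_eq_iff)
  \<comment> \<open>The zeros of \<open>f\<close> form an \<open>N\<close>-null set, so dividing by
    \<open>f\<close> and taking its logarithm are harmless under \<open>N\<close>.\<close>
  have fpos: "AE x in N. 0 < f x"
    by (subst N_eq, subst AE_density) (auto intro!: AE_I2)
  define u where "u x = exp (- h x) / (C * f x)" for x
  have [measurable]: "u \<in> borel_measurable M"
    unfolding u_def by measurable
  \<comment> \<open>Where \<open>f\<close> vanishes, division by zero makes \<open>u\<close> zero.
    The resulting indicator is the reason why the integral of \<open>u\<close> is bounded by 1 and
    not shown equal to it.\<close>
  have fu: "f x * u x = indicator {x. 0 < f x} x * (exp (- h x) / C)" for x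
    using f0[of x] by (auto simp: u_def indicator_def)
  have intM: "integrable M (\<lambda>x. exp (- h x) / C)"
    using integral_exp_bounded(1)[OF _ h] by auto
  have intfu: "integrable M (\<lambda>x. f x * u x)"
    unfolding fu using C by (intro Bochner_Integration.integrable_bound[OF intM]) (auto intro!: AE_I2 simp: indicator_def)
  have intu: "integrable N u"
    by (subst N_eq, subst integrable_density) (use f0 intfu in auto)
  have "(\<integral>x. u x \<partial>N) = (\<integral>x. f x * u x \<partial>M)"
    by (subst N_eq, subst integral_density) (use f0 in auto)
  also have "\<dots> \<le> (\<integral>x. exp (- h x) / C \<partial>M)"
    using C by (intro integral_mono intfu intM) (auto simp: fu indicator_def)
  also have "\<dots> = 1"
    using C by (simp add: C_def)
  finally have u1: "(\<integral>x. u x \<partial>N) \<le> 1" .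
  have inth: "integrable N h"
    by (rule N.integrable_const_bound[of _ B])
      (use h sets_eq_imp_space_eq[OF N(2)] in \<open>auto intro!: AE_I2\<close>)
  have intl: "integrable N (\<lambda>x. ln (f x))"
    using int by (simp add: ent)
  have "AE x in N. 1 - u x \<le> h x + ln (f x) + ln C"
    using fpos
  proof eventually_elim
    case (elim x)
    have "ln (u x) \<le> u x - 1"
      using elim C by (intro ln_le_minus_one) (auto simp: u_def)
    moreover have "ln (u x) = - h x - (ln C + ln (f x))"
      using elim C by (simp add: u_def ln_div ln_mult)
    ultimately show ?case by simp
  qed
  then have "(\<integral>x. 1 - u x \<partial>N) \<le> (\<integral>x. h x + ln (f x) + ln C \<partial>N)"
    using intu inth intl by (intro integral_mono_AE) auto
  then have "0 \<le> (\<integral>x. h x \<partial>N) + (\<integral>x. ln (f x) \<partial>N) + ln C"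
    using u1 intu inth intl by (simp add: N.prob_space)
  then show ?thesis
    by (simp add: KL_divergence_def ent C_def)
qed

text \<open>The equality case of the variational formula: the log-density of the Gibbs measure is
  \<open>- h x - ln C\<close>. It is bounded, so the divergence is finite and is the integral of
  this expression.\<close>

lemma KL_gibbs:
  assumes [measurable]: "h \<in> borel_measurable M" and h: "\<And>x. x \<in> space M \<Longrightarrow> \<bar>h x :: real\<bar> \<le> B"
  shows "KL (gibbs M h) M = ereal (- ln (expectation (\<lambda>x. exp (- h x))) - (\<integral>x. h x \<partial>gibbs M h))"
proof -
  interpret N: prob_space "gibbs M h"
    by (rule prob_space_gibbs[OF assms])
  define C where "C = expectation (\<lambda>x. exp (- h x))"
  have C: "0 < C"
    unfolding C_def by (rule integral_exp_bounded(2)[OF _ h]) auto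
  have dens: "gibbs M h = density M (\<lambda>x. ennreal (exp (- h x) / C))"
    by (simp add: gibbs_def C_def)
  have [measurable_cong]: "sets (gibbs M h) = sets M"
    by (simp add: dens)
  have ac: "absolutely_continuous M (gibbs M h)"
    unfolding dens by (rule absolutely_continuousI_density) measurable
  have "AE x in M. ennreal (exp (- h x) / C) = RN_deriv M (gibbs M h) x"
    by (rule RN_deriv_unique) (auto simp: dens)
  \<comment> \<open>The derivative is determined up to \<open>M\<close>-null sets; absolute
    continuity makes these null for the Gibbs measure, under which the log-density is
    integrated.\<close>
  then have "AE x in gibbs M h. ennreal (exp (- h x) / C) = RN_deriv M (gibbs M h) x"
    by (rule absolutely_continuous_AE[OF _ ac, rotated]) (simp add: dens)
  then have eq: "AE x in gibbs M h. entropy_density (exp 1) M (gibbs M h) x = - h x - ln C"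
  proof eventually_elim
    case (elim x)
    have "enn2real (RN_deriv M (gibbs M h) x) = exp (- h x) / C"
      using C by (simp flip: elim)
    then show ?case
      using C by (simp add: entropy_density_def log_def ln_div)
  qed
  have [measurable]: "entropy_density (exp 1) M (gibbs M h) \<in> borel_measurable M"
    by (rule measurable_entropy_density)
  have inth: "integrable (gibbs M h) h"
    by (rule N.integrable_const_bound[of _ B]) (use h in \<open>auto intro!: AE_I2 simp: dens\<close>)
  have "integrable (gibbs M h) (entropy_density (exp 1) M (gibbs M h))
      \<longleftrightarrow> integrable (gibbs M h) (\<lambda>x. - h x - ln C)"
    by (rule integrable_cong_AE) (use eq in auto)
  then have int: "integrable (gibbs M h) (entropy_density (exp 1) M (gibbs M h))"
    using inth by auto
  have "KL_divergence (exp 1) M (gibbs M h) = (\<integral>x. - h x - ln C \<partial>gibbs M h)"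
    unfolding KL_divergence_def by (rule integral_cong_AE) (use eq in auto)
  also have "\<dots> = - (\<integral>x. h x \<partial>gibbs M h) - ln C"
    using inth by (simp add: N.prob_space)
  finally show ?thesis
    using ac int by (simp add: KL_def C_def)
qed

end

subsection \<open>The law of the SeqRand output\<close>

text \<open>By \<open>mSuc\<close> the law of the next draw is the same for every history
  \<open>gs\<close>, so each step appends a coordinate of law \<open>m (Suc i)\<close> and keeps the
  old marginals. Only marginals matter later, because the output is a single coordinate. The
  induction also carries membership in \<open>prob_algebra\<close>, which the kernel lemmas
  require.\<close>

lemma seqrand_draws_marginals:
  assumes m: "\<And>i. i \<le> n \<Longrightarrow> m i \<in> space (prob_algebra G)"
    and m0: "m 0 = \<pi>"
    and mSuc: "\<And>i gs. i < n \<Longrightarrow> gibbs \<pi> (\<lambda>g. lam * seqrand_score L \<delta> z gs (Suc i) g) = m (Suc i)"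
    and "i \<le> n"
  shows "seqrand_draws G L lam \<delta> (\<lambda>\<rho>. \<rho>) \<pi> z i \<in> space (prob_algebra (PiM {..i} (\<lambda>_. G))) \<and>
    (\<forall>k\<le>i. distr (seqrand_draws G L lam \<delta> (\<lambda>\<rho>. \<rho>) \<pi> z i) G (\<lambda>gs. gs k) = m k)"
  using \<open>i \<le> n\<close>
proof (induction i)
  case 0
  have [measurable_cong]: "sets (m 0) = sets G" and "prob_space (m 0)"
    using m[of 0] by (auto simp: space_prob_algebra)
  then interpret prob_space "m 0" by simp
  have meas: "(\<lambda>g. \<lambda>j\<in>{..0::nat}. g) \<in> m 0 \<rightarrow>\<^sub>M PiM {..0} (\<lambda>_. G)"
    by measurable
  have "distr (distr (m 0) (PiM {..0} (\<lambda>_. G)) (\<lambda>g. \<lambda>j\<in>{..0::nat}. g)) G (\<lambda>gs. gs 0)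
      = distr (m 0) G (\<lambda>g. g)"
    using meas by (subst distr_distr) (auto simp: comp_def)
  also have "\<dots> = m 0"
    by (rule distr_id2) (simp add: \<open>sets (m 0) = sets G\<close>)
  finally show ?case
    using prob_space_distr[OF meas] by (simp add: m0 space_prob_algebra)
next
  case (Suc i)
  define D where "D = seqrand_draws G L lam \<delta> (\<lambda>\<rho>. \<rho>) \<pi> z i"
  define N where "N j = PiM {..j} (\<lambda>_::nat. G)" for j
  \<comment> \<open>The kernel of one step: the history enters only by being copied.\<close>
  define K where "K gs = distr (m (Suc i)) (N (Suc i)) (\<lambda>g. gs(Suc i := g))" for gs :: "nat \<Rightarrow> 'a"
  have D: "D \<in> space (prob_algebra (N i))" and marg: "\<And>k. k \<le> i \<Longrightarrow> distr D G (\<lambda>gs. gs k) = m k"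
    using Suc by (auto simp: D_def N_def)
  have mS: "m (Suc i) \<in> space (prob_algebra G)"
    using m Suc.prems by blast
  then have smS[measurable_cong]: "sets (m (Suc i)) = sets G"
    by (auto simp: space_prob_algebra)
  have sD[measurable_cong]: "sets D = sets (N i)" and pD: "prob_space D"
    using D by (auto simp: space_prob_algebra)
  interpret D: prob_space D by fact
  have upd[measurable]: "(\<lambda>(gs, g). gs(Suc i := g)) \<in> N i \<Otimes>\<^sub>M G \<rightarrow>\<^sub>M N (Suc i)"
    unfolding N_def by (subst split_beta', rule measurable_fun_upd[where J = "{..i}"]) auto
  have K: "K \<in> N i \<rightarrow>\<^sub>M prob_algebra (N (Suc i))"
    unfolding K_def by (rule measurable_distr_prob_space2[where M = G]) (use mS in auto)
  then have K': "K \<in> D \<rightarrow>\<^sub>M subprob_algebra (N (Suc i))"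
    by (intro measurable_prob_algebraD) (simp cong: measurable_cong_sets add: sD)
  have D_Suc: "seqrand_draws G L lam \<delta> (\<lambda>\<rho>. \<rho>) \<pi> z (Suc i) = D \<bind> K"
    using Suc.prems by (simp add: D_def K_def[abs_def] N_def mSuc del: seqrand_score.simps)
  have upd1: "(\<lambda>g. gs(Suc i := g)) \<in> m (Suc i) \<rightarrow>\<^sub>M N (Suc i)" if "gs \<in> space D" for gs
    using that measurable_Pair2[OF upd, of gs] sets_eq_imp_space_eq[OF sD]
    by (simp cong: measurable_cong_sets add: \<open>sets (m (Suc i)) = sets G\<close>)
  have comp: "(\<lambda>gs. gs k) \<in> N j \<rightarrow>\<^sub>M G" if "k \<le> j" for k j
    unfolding N_def using that by (intro measurable_component_singleton) simp
  have "distr (D \<bind> K) G (\<lambda>gs. gs k) = m k" if "k \<le> Suc i" for k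
  proof -
    have 1: "distr (D \<bind> K) G (\<lambda>gs. gs k) = D \<bind> (\<lambda>gs. distr (K gs) G (\<lambda>gs. gs k))"
      by (rule distr_bind[OF K' D.not_empty comp[OF that]])
    have 2: "distr (K gs) G (\<lambda>gs. gs k) = distr (m (Suc i)) G (\<lambda>g. (gs(Suc i := g)) k)"
      if "gs \<in> space D" for gs
      unfolding K_def using comp[OF \<open>k \<le> Suc i\<close>] upd1[OF that] by (subst distr_distr) (auto simp: comp_def)
    show ?thesis
    proof (cases "k = Suc i")
      case True
      \<comment> \<open>The new coordinate has law \<open>m k\<close> whatever the history is, so
        the mixture over \<open>D\<close> collapses to it.\<close>
      have "D \<bind> (\<lambda>gs. distr (K gs) G (\<lambda>gs. gs k)) = D \<bind> (\<lambda>_. m k)"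
        by (intro bind_cong refl, subst 2) (auto simp: True intro!: distr_id2 smS[symmetric])
      also have "\<dots> = m k"
        using mS True by (intro bind_const' pD) (auto simp: space_prob_algebra prob_space_imp_subprob_space)
      finally show ?thesis using 1 by simp
    next
      case False
      with that have "k \<le> i" by simp
      \<comment> \<open>An old coordinate is constant under \<open>K gs\<close>, hence a point mass;
        mixing point masses over \<open>D\<close> returns the old marginal.\<close>
      have "distr (K gs) G (\<lambda>gs. gs k) = return G (gs k)" if "gs \<in> space D" for gs
      proof -
        have "prob_space (m (Suc i))" using mS by (simp add: space_prob_algebra)
        moreover have "gs k \<in> space G"
          using measurable_space[OF comp[OF \<open>k \<le> i\<close>]] that sets_eq_imp_space_eq[OF sD] by simp
        ultimately show ?thesis
          using False by (simp add: 2[OF that] prob_space.distr_const)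
      qed
      then have "D \<bind> (\<lambda>gs. distr (K gs) G (\<lambda>gs. gs k)) = D \<bind> (\<lambda>gs. return G (gs k))"
        by (intro bind_cong) auto
      also have "\<dots> = distr D G (\<lambda>gs. gs k)"
        by (rule bind_return_distr'[OF D.not_empty])
          (use comp[OF \<open>k \<le> i\<close>] in \<open>simp cong: measurable_cong_sets add: sD\<close>)
      also have "\<dots> = m k"
        by (rule marg[OF \<open>k \<le> i\<close>])
      finally show ?thesis using 1 by simp
    qed
  qed
  moreover have "D \<bind> K \<in> space (prob_algebra (N (Suc i)))"
    using prob_space_bind'[OF D K] sets_bind'[OF D K] by (simp add: space_prob_algebra)
  ultimately show ?case
    by (simp add: D_Suc[unfolded N_def] N_def del: seqrand_draws.simps)
qed

text \<open>The output law is the mixture of the marginals \<open>m k\<close> with equal weights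
  \<open>1 / (n + 1)\<close>. For nonnegative integrands the integral passes through the two random
  choices without integrability conditions.\<close>

lemma
  assumes m: "\<And>i. i \<le> n \<Longrightarrow> m i \<in> space (prob_algebra G)"
    and m0: "m 0 = \<pi>"
    and mSuc: "\<And>i gs. i < n \<Longrightarrow> gibbs \<pi> (\<lambda>g. lam * seqrand_score L \<delta> z gs (Suc i) g) = m (Suc i)"
  shows sets_seqrand: "sets (seqrand G L lam \<delta> (\<lambda>\<rho>. \<rho>) \<pi> n z) = sets G"
    and nn_integral_seqrand: "f \<in> borel_measurable G \<Longrightarrow> (\<integral>\<^sup>+g. f g \<partial>seqrand G L lam \<delta> (\<lambda>\<rho>. \<rho>) \<pi> n z)
    = (\<Sum>k\<le>n. ennreal (1 / (real n + 1)) * (\<integral>\<^sup>+g. f g \<partial>m k))"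
proof -
  define D where "D = seqrand_draws G L lam \<delta> (\<lambda>\<rho>. \<rho>) \<pi> z n"
  have D: "D \<in> space (prob_algebra (PiM {..n} (\<lambda>_. G)))"
    and marg: "\<And>k. k \<le> n \<Longrightarrow> distr D G (\<lambda>gs. gs k) = m k"
    using seqrand_draws_marginals[where m = m and G = G, OF m m0 mSuc order_refl] by (auto simp: D_def)
  have sD[measurable_cong]: "sets D = sets (PiM {..n} (\<lambda>_. G))"
    using D by (auto simp: space_prob_algebra)
  define U where "U = uniform_count_measure {..n}"
  have comp: "(\<lambda>gs. gs k) \<in> PiM {..n} (\<lambda>_. G) \<rightarrow>\<^sub>M G" if "k \<le> n" for k
    using that by (intro measurable_component_singleton) simp
  \<comment> \<open>Evaluation is jointly measurable since the index set is finite; this makes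
    \<open>distr U G gs\<close> a measurable kernel in \<open>gs\<close>.\<close>
  have "(\<lambda>(gs, k). gs k) \<in> PiM {..n} (\<lambda>_. G) \<Otimes>\<^sub>M count_space {..n} \<rightarrow>\<^sub>M G"
    unfolding split_beta'
    by (rule measurable_compose_countable'[where I = "{..n}" and g = snd and f = "\<lambda>k p. fst p k"]) auto
  then have ev: "(\<lambda>(gs, k). gs k) \<in> PiM {..n} (\<lambda>_. G) \<Otimes>\<^sub>M U \<rightarrow>\<^sub>M G"
    by (subst measurable_cong_sets[OF sets_pair_measure_cong[OF refl] refl])
      (auto simp: U_def sets_uniform_count_measure_count_space)
  have "subprob_space U"
    unfolding U_def by (intro prob_space_imp_subprob_space prob_space_uniform_count_measure) auto
  then have K: "(\<lambda>gs. distr U G gs) \<in> D \<rightarrow>\<^sub>M subprob_algebra G"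
    using ev by (subst measurable_cong_sets[OF sD refl]) (intro measurable_distr2[where M = U]; simp add: space_subprob_algebra)
  have "prob_space D"
    using D by (simp add: space_prob_algebra)
  then show "sets (seqrand G L lam \<delta> (\<lambda>\<rho>. \<rho>) \<pi> n z) = sets G"
    unfolding seqrand_def D_def[symmetric] U_def[symmetric]
    by (intro sets_bind_measurable[OF K] prob_space.not_empty)
  assume f[measurable]: "f \<in> borel_measurable G"
  have "(\<integral>\<^sup>+g. f g \<partial>seqrand G L lam \<delta> (\<lambda>\<rho>. \<rho>) \<pi> n z) = (\<integral>\<^sup>+gs. \<integral>\<^sup>+g. f g \<partial>distr U G gs \<partial>D)"
    unfolding seqrand_def D_def[symmetric] U_def[symmetric] by (rule nn_integral_bind[OF f K])
  also have "\<dots> = (\<integral>\<^sup>+gs. (\<Sum>k\<le>n. ennreal (1 / (real n + 1)) * f (gs k)) \<partial>D)"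
  proof (rule nn_integral_cong)
    fix gs assume gs: "gs \<in> space D"
    then have "gs k \<in> space G" if "k \<le> n" for k
      using measurable_space[OF comp[OF that]] sets_eq_imp_space_eq[OF sD] by simp
    then have [measurable]: "gs \<in> U \<rightarrow>\<^sub>M G"
      by (auto simp: U_def measurable_def space_uniform_count_measure sets_uniform_count_measure)
    have "(\<integral>\<^sup>+g. f g \<partial>distr U G gs) = (\<integral>\<^sup>+k. f (gs k) \<partial>U)"
      by (rule nn_integral_distr) auto
    also have "\<dots> = (\<Sum>k\<le>n. ennreal (1 / (real n + 1)) * f (gs k))"
      unfolding U_def uniform_count_measure_def
      by (subst nn_integral_point_measure_finite) (auto simp: add.commute)
    finally show "(\<integral>\<^sup>+g. f g \<partial>distr U G gs) = \<dots>" .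
  qed
  also have "\<dots> = (\<Sum>k\<le>n. \<integral>\<^sup>+gs. ennreal (1 / (real n + 1)) * f (gs k) \<partial>D)"
    by (rule nn_integral_sum) (auto intro!: measurable_compose[OF _ f] comp simp: measurable_cong_sets[OF sD refl])
  also have "\<dots> = (\<Sum>k\<le>n. ennreal (1 / (real n + 1)) * (\<integral>\<^sup>+g. f g \<partial>m k))"
  proof (rule sum.cong[OF refl])
    fix k assume "k \<in> {..n}"
    then have k: "k \<le> n" by simp
    then have [measurable]: "(\<lambda>gs. gs k) \<in> D \<rightarrow>\<^sub>M G"
      using comp by (simp add: measurable_cong_sets[OF sD refl])
    show "(\<integral>\<^sup>+gs. ennreal (1 / (real n + 1)) * f (gs k) \<partial>D) = ennreal (1 / (real n + 1)) * (\<integral>\<^sup>+g. f g \<partial>m k)"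
      by (subst nn_integral_cmult) (auto simp: nn_integral_distr simp flip: marg[OF k])
  qed
  finally show "(\<integral>\<^sup>+g. f g \<partial>seqrand G L lam \<delta> (\<lambda>\<rho>. \<rho>) \<pi> n z) = \<dots>" .
qed

text \<open>Adding \<open>B\<close> makes \<open>f\<close> nonnegative, so the mixture formula for
  nonnegative integrals applies; the weights sum to 1, so \<open>B\<close> can be subtracted
  again.\<close>

lemma integral_seqrand:
  assumes m: "\<And>i. i \<le> n \<Longrightarrow> m i \<in> space (prob_algebra G)"
    and m0: "m 0 = \<pi>"
    and mSuc: "\<And>i gs. i < n \<Longrightarrow> gibbs \<pi> (\<lambda>g. lam * seqrand_score L \<delta> z gs (Suc i) g) = m (Suc i)"
    and f[measurable]: "f \<in> borel_measurable G"
    and bd: "\<And>g. g \<in> space G \<Longrightarrow> \<bar>f g :: real\<bar> \<le> B"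
  shows "(\<integral>g. f g \<partial>seqrand G L lam \<delta> (\<lambda>\<rho>. \<rho>) \<pi> n z) = (\<Sum>k\<le>n. \<integral>g. f g \<partial>m k) / (real n + 1)"
proof -
  let ?S = "seqrand G L lam \<delta> (\<lambda>\<rho>. \<rho>) \<pi> n z"
  have nn: "(\<integral>\<^sup>+g. h g \<partial>?S) = (\<Sum>k\<le>n. ennreal (1 / (real n + 1)) * (\<integral>\<^sup>+g. h g \<partial>m k))"
    if "h \<in> borel_measurable G" for h
    by (rule nn_integral_seqrand[where m = m, OF m m0 mSuc that])
  have mk: "prob_space (m k)" "sets (m k) = sets G" if "k \<le> n" for k
    using m[OF that] by (auto simp: space_prob_algebra)
  have intm: "integrable (m k) f" if "k \<le> n" for k
  proof -
    interpret prob_space "m k" by (rule mk[OF that])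
    show ?thesis
      by (rule integrable_const_bound[of _ B])
        (use bd mk(2)[OF that] sets_eq_imp_space_eq[OF mk(2)[OF that]] in \<open>auto cong: measurable_cong_sets\<close>)
  qed
  have S_sets[measurable_cong]: "sets ?S = sets G"
    by (rule sets_seqrand[where m = m, OF m m0 mSuc])
  \<comment> \<open>Testing with the constant 1 shows that the output law has total mass 1, so that
    bounded functions are integrable under it.\<close>
  have "(\<integral>\<^sup>+g. 1 \<partial>?S) = (\<Sum>k\<le>n. ennreal (1 / (real n + 1)) * (\<integral>\<^sup>+g. 1 \<partial>m k))"
    by (rule nn[OF borel_measurable_const])
  also have "\<dots> = (\<Sum>k\<le>n. ennreal (1 / (real n + 1)))"
    by (intro sum.cong) (auto simp: prob_space.emeasure_space_1[OF mk(1)])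
  also have "\<dots> = 1"
    by (subst sum_ennreal) (auto simp: field_simps)
  finally interpret S: prob_space ?S
    by (intro prob_spaceI) simp
  have intS: "integrable ?S f"
    by (rule S.integrable_const_bound[of _ B]) (use bd sets_eq_imp_space_eq[OF S_sets] in auto)
  have shift: "(\<integral>\<^sup>+g. ennreal (f g + B) \<partial>N) = ennreal ((\<integral>g. f g \<partial>N) + B)" and shift_nonneg: "0 \<le> (\<integral>g. f g \<partial>N) + B"
    if N: "prob_space N" "sets N = sets G" "integrable N f" for N
  proof -
    interpret prob_space N by fact
    have pos: "AE g in N. 0 \<le> f g + B"
      using bd sets_eq_imp_space_eq[OF N(2)] by (fastforce intro!: AE_I2 simp: abs_le_iff)
    have "(\<integral>\<^sup>+g. ennreal (f g + B) \<partial>N) = ennreal (\<integral>g. f g + B \<partial>N)"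
      using N pos by (intro nn_integral_eq_integral) auto
    then show "(\<integral>\<^sup>+g. ennreal (f g + B) \<partial>N) = ennreal ((\<integral>g. f g \<partial>N) + B)"
      using N by (simp add: prob_space)
    have "0 \<le> (\<integral>g. f g + B \<partial>N)"
      by (rule integral_nonneg_AE[OF pos])
    then show "0 \<le> (\<integral>g. f g \<partial>N) + B"
      using N by (simp add: prob_space)
  qed
  have "ennreal ((\<integral>g. f g \<partial>?S) + B) = (\<integral>\<^sup>+g. ennreal (f g + B) \<partial>?S)"
    by (rule shift[symmetric]) (fact S.prob_space_axioms S_sets intS)+
  also have "\<dots> = (\<Sum>k\<le>n. ennreal (1 / (real n + 1)) * (\<integral>\<^sup>+g. ennreal (f g + B) \<partial>m k))"
    by (intro nn) measurable
  also have "\<dots> = (\<Sum>k\<le>n. ennreal (1 / (real n + 1) * ((\<integral>g. f g \<partial>m k) + B)))"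
    using shift[OF mk intm] shift_nonneg[OF mk intm] by (intro sum.cong refl) (simp flip: ennreal_mult')
  also have "\<dots> = ennreal (\<Sum>k\<le>n. 1 / (real n + 1) * ((\<integral>g. f g \<partial>m k) + B))"
    using shift_nonneg[OF mk intm] by (intro sum_ennreal) auto
  finally have "(\<integral>g. f g \<partial>?S) + B = (\<Sum>k\<le>n. 1 / (real n + 1) * ((\<integral>g. f g \<partial>m k) + B))"
    using shift_nonneg[OF mk intm] shift_nonneg[OF S.prob_space_axioms S_sets intS]
    by (subst (asm) ennreal_inj) (auto intro!: sum_nonneg)
  also have "\<dots> = (\<Sum>k\<le>n. \<integral>g. f g \<partial>m k) / (real n + 1) + B"
    by (simp add: sum.distrib field_simps flip: sum_distrib_left sum_divide_distrib)
  finally show ?thesis by simp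
qed

subsection \<open>Expected risk of Gibbs posteriors\<close>

locale bounded_loss = data: prob_space P + prior: prob_space \<pi>
  for P :: "'z measure" and \<pi> :: "'g measure" +
  fixes L :: "'z \<Rightarrow> 'g \<Rightarrow> real" and a b lam :: real
  assumes loss_measurable: "(\<lambda>(z, g). L z g) \<in> borel_measurable (P \<Otimes>\<^sub>M \<pi>)"
    and loss_bounded: "\<And>z g. z \<in> space P \<Longrightarrow> g \<in> space \<pi> \<Longrightarrow> a \<le> L z g \<and> L z g \<le> b"
begin

declare One_nat_def [simp del]

text \<open>The constant increments of the score are left out, since the Gibbs measure does not see
  them.\<close>

definition cumulative_loss :: "nat \<Rightarrow> (nat \<Rightarrow> 'z) \<Rightarrow> 'g \<Rightarrow> real"
  where "cumulative_loss k z g = (\<Sum>j=1..k. L (z j) g)"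

definition posterior :: "nat \<Rightarrow> (nat \<Rightarrow> 'z) \<Rightarrow> 'g measure"
  where "posterior k z = gibbs \<pi> (\<lambda>g. lam * cumulative_loss k z g)"

definition posterior_risk :: "nat \<Rightarrow> (nat \<Rightarrow> 'z) \<Rightarrow> real"
  where "posterior_risk k z = (\<integral>g. risk P L g \<partial>posterior k z)"

text \<open>The potential of the argument: up to a constant, each expected loss is paid for by its
  decrease.\<close>

definition log_partition :: "nat \<Rightarrow> (nat \<Rightarrow> 'z) \<Rightarrow> real"
  where "log_partition k z = ln (\<integral>g. exp (- (lam * cumulative_loss k z g)) \<partial>\<pi>)"

abbreviation sample :: "nat \<Rightarrow> (nat \<Rightarrow> 'z) measure"
  where "sample k \<equiv> PiM {1..k} (\<lambda>_. P)"

text \<open>Membership in \<open>space (sample k)\<close> would also prescribe the values outside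
  \<open>{1..k}\<close>. This weaker condition also covers full sequences such as
  \<open>\<lambda>i. Z i \<omega>\<close>.\<close>

abbreviation valid :: "nat \<Rightarrow> (nat \<Rightarrow> 'z) \<Rightarrow> bool"
  where "valid k z \<equiv> \<forall>j\<in>{1..k}. z j \<in> space P"

section \<open>Measurability, bounds and integrability of the posterior quantities\<close>

lemma measurable_loss[measurable (raw)]:
  assumes "f \<in> M \<rightarrow>\<^sub>M P" "g \<in> M \<rightarrow>\<^sub>M \<pi>"
  shows "(\<lambda>x. L (f x) (g x)) \<in> borel_measurable M"
  using measurable_compose[OF measurable_Pair[OF assms] loss_measurable] by simp

lemma valid_sample: "z \<in> space (sample k) \<Longrightarrow> valid k z"
  by (auto simp: space_PiM PiE_iff)

lemma loss_abs_le: "z \<in> space P \<Longrightarrow> g \<in> space \<pi> \<Longrightarrow> \<bar>L z g\<bar> \<le> max \<bar>a\<bar> \<bar>b\<bar>"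
  using loss_bounded[of z g] by auto

lemma integrable_loss: "g \<in> space \<pi> \<Longrightarrow> integrable P (\<lambda>z. L z g)"
  by (rule data.integrable_const_bound[of _ "max \<bar>a\<bar> \<bar>b\<bar>"]) (auto intro!: loss_abs_le)

lemma measurable_risk[measurable]: "risk P L \<in> borel_measurable \<pi>"
  unfolding risk_def[abs_def] by measurable

lemma risk_bounded: "g \<in> space \<pi> \<Longrightarrow> a \<le> risk P L g \<and> risk P L g \<le> b"
  using data.integral_ge_const[OF integrable_loss, of g a] data.integral_le_const[OF integrable_loss, of g b]
    loss_bounded by (auto simp: risk_def)

lemma risk_abs_le: "g \<in> space \<pi> \<Longrightarrow> \<bar>risk P L g\<bar> \<le> max \<bar>a\<bar> \<bar>b\<bar>"
  using risk_bounded[of g] by auto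

lemma measurable_cumulative_loss[measurable]: "valid k z \<Longrightarrow> cumulative_loss k z \<in> borel_measurable \<pi>"
  unfolding cumulative_loss_def[abs_def] by (intro borel_measurable_sum measurable_loss) auto

lemma measurable_cumulative_loss_pair[measurable (raw)]:
  assumes "f \<in> M \<rightarrow>\<^sub>M sample k" "g \<in> M \<rightarrow>\<^sub>M \<pi>"
  shows "(\<lambda>x. cumulative_loss k (f x) (g x)) \<in> borel_measurable M"
  unfolding cumulative_loss_def
  by (intro borel_measurable_sum measurable_loss assms(2) measurable_compose[OF assms(1)]) auto

lemma cumulative_loss_abs_le:
  assumes "valid k z" "g \<in> space \<pi>"
  shows "\<bar>lam * cumulative_loss k z g\<bar> \<le> \<bar>lam\<bar> * (real k * max \<bar>a\<bar> \<bar>b\<bar>)"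
proof -
  have "\<bar>cumulative_loss k z g\<bar> \<le> (\<Sum>j=1..k. \<bar>L (z j) g\<bar>)"
    unfolding cumulative_loss_def by (rule sum_abs)
  also have "\<dots> \<le> (\<Sum>j=1..k. max \<bar>a\<bar> \<bar>b\<bar>)"
    using assms by (intro sum_mono loss_abs_le) auto
  finally show ?thesis
    by (simp add: abs_mult mult_left_mono)
qed

lemma partition_function:
  assumes "valid k z"
  shows "integrable \<pi> (\<lambda>g. exp (- (lam * cumulative_loss k z g)))"
    and "0 < (\<integral>g. exp (- (lam * cumulative_loss k z g)) \<partial>\<pi>)"
  using prior.integral_exp_bounded[of "\<lambda>g. lam * cumulative_loss k z g", OF _ cumulative_loss_abs_le[OF assms]]
    assms by auto

lemma posterior: "valid k z \<Longrightarrow> prob_space (posterior k z)"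
  unfolding posterior_def by (rule prior.prob_space_gibbs[OF _ cumulative_loss_abs_le]) auto

lemma sets_posterior[simp, measurable_cong]: "sets (posterior k z) = sets \<pi>"
  by (simp add: posterior_def gibbs_def)

lemma space_posterior[simp]: "space (posterior k z) = space \<pi>"
  by (rule sets_eq_imp_space_eq) simp

lemma integral_posterior:
  "valid k z \<Longrightarrow> f \<in> borel_measurable \<pi> \<Longrightarrow> (\<integral>g. f g \<partial>posterior k z) =
    (\<integral>g. f g * exp (- (lam * cumulative_loss k z g)) \<partial>\<pi>) / (\<integral>g. exp (- (lam * cumulative_loss k z g)) \<partial>\<pi>)"
  unfolding posterior_def by (rule prior.integral_gibbs[OF _ cumulative_loss_abs_le]) auto

lemma integrable_posterior:
  assumes "valid k z" and [measurable]: "f \<in> borel_measurable \<pi>" and "\<And>g. g \<in> space \<pi> \<Longrightarrow> \<bar>f g\<bar> \<le> (B::real)"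
  shows "integrable (posterior k z) f"
proof -
  interpret prob_space "posterior k z" by (rule posterior) fact
  show ?thesis
    by (rule integrable_const_bound[of _ B]) (use assms(3) in auto)
qed

text \<open>The measure \<open>posterior k z\<close> varies with \<open>z\<close>. Written as a
  quotient of two integrals over the fixed \<open>\<pi>\<close>, the posterior risk becomes a
  quotient of parametric integrals.\<close>

lemma measurable_posterior_risk[measurable]: "posterior_risk k \<in> borel_measurable (sample k)"
proof -
  have "(\<lambda>z. (\<integral>g. risk P L g * exp (- (lam * cumulative_loss k z g)) \<partial>\<pi>) /
      (\<integral>g. exp (- (lam * cumulative_loss k z g)) \<partial>\<pi>)) \<in> borel_measurable (sample k)"
    by measurable
  then show ?thesis
    by (rule measurable_cong[THEN iffD1, rotated])
      (simp add: posterior_risk_def integral_posterior[OF valid_sample])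
qed

lemma posterior_risk_bounded:
  assumes "valid k z"
  shows "a \<le> posterior_risk k z \<and> posterior_risk k z \<le> b"
proof -
  interpret prob_space "posterior k z" by (rule posterior) fact
  have "integrable (posterior k z) (risk P L)"
    by (rule integrable_posterior[OF assms _ risk_abs_le]) auto
  then show ?thesis
    unfolding posterior_risk_def using risk_bounded
    by (auto intro!: integral_ge_const integral_le_const)
qed

lemma measurable_log_partition[measurable]: "log_partition k \<in> borel_measurable (sample k)"
  unfolding log_partition_def[abs_def] by measurable

lemma log_partition_abs_le:
  assumes "valid k z"
  shows "\<bar>log_partition k z\<bar> \<le> \<bar>lam\<bar> * (real k * max \<bar>a\<bar> \<bar>b\<bar>)" (is "_ \<le> ?B")
proof -
  let ?W = "\<integral>g. exp (- (lam * cumulative_loss k z g)) \<partial>\<pi>"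
  have bd: "exp (- ?B) \<le> exp (- (lam * cumulative_loss k z g))" "exp (- (lam * cumulative_loss k z g)) \<le> exp ?B"
    if "g \<in> space \<pi>" for g
    using cumulative_loss_abs_le[OF assms that] by (auto simp: abs_le_iff)
  have "exp (- ?B) \<le> ?W" "?W \<le> exp ?B"
    using partition_function(1)[OF assms] bd
    by (auto intro!: prior.integral_ge_const prior.integral_le_const)
  with partition_function(2)[OF assms] have "- ?B \<le> ln ?W" "ln ?W \<le> ?B"
    by (metis ln_exp ln_le_cancel_iff exp_gt_zero)+
  then show ?thesis
    unfolding log_partition_def by linarith
qed

lemma prob_space_sample: "prob_space (sample k)"
  by (rule prob_space_PiM) (rule data.prob_space_axioms)

lemma integrable_log_partition: "integrable (sample k) (log_partition k)"
proof -
  interpret prob_space "sample k" by (rule prob_space_sample)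
  show ?thesis
    by (rule integrable_const_bound[of _ "\<bar>lam\<bar> * (real k * max \<bar>a\<bar> \<bar>b\<bar>)"])
      (auto simp: log_partition_abs_le[OF valid_sample])
qed

lemma integrable_posterior_risk: "integrable (sample k) (posterior_risk k)"
proof -
  interpret prob_space "sample k" by (rule prob_space_sample)
  have "\<bar>posterior_risk k z\<bar> \<le> max \<bar>a\<bar> \<bar>b\<bar>" if "z \<in> space (sample k)" for z
    using posterior_risk_bounded[OF valid_sample[OF that]] by auto
  then show ?thesis
    by (intro integrable_const_bound[of _ "max \<bar>a\<bar> \<bar>b\<bar>"]) auto
qed

section \<open>One-step inequality and telescoping sum\<close>

lemma cumulative_loss_upd:
  "cumulative_loss (Suc k) (z(Suc k := y)) g = cumulative_loss k z g + L y g"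
  by (simp add: cumulative_loss_def)

text \<open>The exponential moment of a fresh loss under the posterior is the quotient of two
  consecutive partition functions, so the logarithm in Hoeffding's lemma becomes an increment of
  \<open>log_partition\<close>.\<close>

lemma posterior_loss_le:
  assumes z: "valid k z" and y: "y \<in> space P" and "lam > 0"
  shows "(\<integral>g. L y g \<partial>posterior k z) \<le>
    lam * (b - a)\<^sup>2 / 8 - (log_partition (Suc k) (z(Suc k := y)) - log_partition k z) / lam"
proof -
  interpret post: prob_space "posterior k z" by (rule posterior) fact
  have z': "valid (Suc k) (z(Suc k := y))"
    using z y by (auto simp: le_Suc_eq)
  have "exp (- (lam * L y g)) * exp (- (lam * cumulative_loss k z g))
      = exp (- (lam * cumulative_loss (Suc k) (z(Suc k := y)) g))" for g
    by (simp add: cumulative_loss_upd algebra_simps flip: exp_add)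
  then have "(\<integral>g. exp (- (lam * L y g)) \<partial>posterior k z) =
      (\<integral>g. exp (- (lam * cumulative_loss (Suc k) (z(Suc k := y)) g)) \<partial>\<pi>)
      / (\<integral>g. exp (- (lam * cumulative_loss k z g)) \<partial>\<pi>)"
    using y by (subst integral_posterior[OF z]) auto
  then have "ln (\<integral>g. exp (- (lam * L y g)) \<partial>posterior k z) =
      log_partition (Suc k) (z(Suc k := y)) - log_partition k z"
    using ln_divide_pos[OF partition_function(2)[of "Suc k" "z(Suc k := y)", OF z'] partition_function(2)[OF z]]
    by (simp only: log_partition_def)
  moreover have "(\<integral>g. L y g \<partial>posterior k z) \<le>
      lam * (b - a)\<^sup>2 / 8 - ln (\<integral>g. exp (- (lam * L y g)) \<partial>posterior k z) / lam"
    using y loss_bounded[OF y] \<open>lam > 0\<close> by (intro post.Hoeffdings_lemma_ln) auto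
  ultimately show ?thesis
    by simp
qed

text \<open>The one-step inequality is averaged over the fresh observation \<open>y\<close> and then
  over the sample; \<open>z\<close> and \<open>y\<close> together form a sample of size
  \<open>Suc k\<close>.\<close>

lemma expected_posterior_risk_le:
  assumes "lam > 0"
  shows "(\<integral>z. posterior_risk k z \<partial>sample k) \<le> lam * (b - a)\<^sup>2 / 8 -
    ((\<integral>z. log_partition (Suc k) z \<partial>sample (Suc k)) - (\<integral>z. log_partition k z \<partial>sample k)) / lam"
proof -
  interpret sample: prob_space "sample k" by (rule prob_space_sample)
  interpret samples: product_sigma_finite "\<lambda>_::nat. P"
    by (simp add: product_sigma_finite_def data.sigma_finite_measure_axioms)
  have ins: "{1..Suc k} = insert (Suc k) {1..k}" by auto
  define A where "A z = (\<integral>y. log_partition (Suc k) (z(Suc k := y)) \<partial>P)" for z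
  have upd: "(\<lambda>(z, y). z(Suc k := y)) \<in> sample k \<Otimes>\<^sub>M P \<rightarrow>\<^sub>M sample (Suc k)"
    by (subst split_beta', rule measurable_fun_upd[where J = "{1..k}"]) auto
  have mA: "(\<lambda>(z, y). log_partition (Suc k) (z(Suc k := y))) \<in> borel_measurable (sample k \<Otimes>\<^sub>M P)"
    using measurable_compose[OF upd measurable_log_partition] by (simp add: split_beta')
  have bd: "\<bar>log_partition (Suc k) (z(Suc k := y))\<bar> \<le> \<bar>lam\<bar> * (real (Suc k) * max \<bar>a\<bar> \<bar>b\<bar>)"
    if "valid k z" "y \<in> space P" for z y
    using that by (intro log_partition_abs_le) (auto simp: le_Suc_eq)
  have intA1: "integrable P (\<lambda>y. log_partition (Suc k) (z(Suc k := y)))" if "z \<in> space (sample k)" for z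
    using measurable_Pair2[OF mA that] bd[OF valid_sample[OF that]]
    by (intro data.integrable_const_bound[OF AE_I2]) auto
  have intA: "integrable (sample k) A"
  proof (rule sample.integrable_const_bound[OF AE_I2])
    show "A \<in> borel_measurable (sample k)"
      unfolding A_def[abs_def] using mA by (rule data.borel_measurable_lebesgue_integral)
    show "norm (A z) \<le> \<bar>lam\<bar> * (real (Suc k) * max \<bar>a\<bar> \<bar>b\<bar>)" if z: "z \<in> space (sample k)" for z
    proof -
      have "- (\<bar>lam\<bar> * (real (Suc k) * max \<bar>a\<bar> \<bar>b\<bar>)) \<le> A z" "A z \<le> \<bar>lam\<bar> * (real (Suc k) * max \<bar>a\<bar> \<bar>b\<bar>)"
        unfolding A_def using intA1[OF z] bd[OF valid_sample[OF z]]
        by (auto intro!: data.integral_ge_const data.integral_le_const AE_I2 simp: abs_le_iff minus_le_iff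
            simp del: of_nat_Suc)
      then show ?thesis by (simp add: abs_le_iff)
    qed
  qed
  have step: "posterior_risk k z \<le> lam * (b - a)\<^sup>2 / 8 - (A z - log_partition k z) / lam"
    if z: "z \<in> space (sample k)" for z
  proof -
    note v = valid_sample[OF z]
    interpret post: prob_space "posterior k z" by (rule posterior) fact
    interpret pair_prob_space P "posterior k z" ..
    have [measurable]: "(\<lambda>(y, g). L y g) \<in> borel_measurable (P \<Otimes>\<^sub>M posterior k z)"
      by measurable
    have int: "integrable (P \<Otimes>\<^sub>M posterior k z) (\<lambda>(y, g). L y g)"
      by (rule integrable_const_bound[of _ "max \<bar>a\<bar> \<bar>b\<bar>"]) (auto intro!: AE_I2 loss_abs_le simp: space_pair_measure)
    \<comment> \<open>Exchanging the integrals turns the posterior mean of the risk into the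
      expected posterior loss on a fresh observation.\<close>
    have "posterior_risk k z = (\<integral>y. (\<integral>g. L y g \<partial>posterior k z) \<partial>P)"
      unfolding posterior_risk_def risk_def by (rule Fubini_integral[OF int])
    also have "\<dots> \<le> (\<integral>y. lam * (b - a)\<^sup>2 / 8 - (log_partition (Suc k) (z(Suc k := y)) - log_partition k z) / lam \<partial>P)"
      using integrable_fst[OF int] intA1[OF z] posterior_loss_le[OF v _ assms]
      by (intro integral_mono) auto
    also have "\<dots> = lam * (b - a)\<^sup>2 / 8 - (A z - log_partition k z) / lam"
      using intA1[OF z] by (simp add: A_def data.prob_space)
    finally show ?thesis .
  qed
  have "(\<integral>z. posterior_risk k z \<partial>sample k) \<le>
      (\<integral>z. lam * (b - a)\<^sup>2 / 8 - (A z - log_partition k z) / lam \<partial>sample k)"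
    using step
    by (intro integral_mono Bochner_Integration.integrable_diff integrable_divide_zero sample.integrable_const
        intA integrable_log_partition integrable_posterior_risk)
  also have "\<dots> = lam * (b - a)\<^sup>2 / 8 - ((\<integral>z. A z \<partial>sample k) - (\<integral>z. log_partition k z \<partial>sample k)) / lam"
    using intA integrable_log_partition by (simp add: sample.prob_space)
  also have "(\<integral>z. A z \<partial>sample k) = (\<integral>z. log_partition (Suc k) z \<partial>sample (Suc k))"
    unfolding A_def ins
    by (rule samples.product_integral_insert[symmetric]) (use integrable_log_partition[of "Suc k"] in \<open>auto simp: ins\<close>)
  finally show ?thesis .
qed

text \<open>The variational inequality is applied with the minimiser for the expected cumulative loss, which
  does not depend on \<open>z\<close>; this makes the expectation over the sample linear.\<close>

lemma expected_log_partition_ge: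
  "ln (\<integral>g. exp (- (lam * real k * risk P L g)) \<partial>\<pi>) \<le> (\<integral>z. log_partition k z \<partial>sample k)"
proof -
  interpret sample: prob_space "sample k" by (rule prob_space_sample)
  define H where "H g = lam * real k * risk P L g" for g
  define N where "N = gibbs \<pi> H"
  have H[measurable]: "H \<in> borel_measurable \<pi>"
    unfolding H_def[abs_def] by measurable
  have H_bd: "\<bar>H g\<bar> \<le> \<bar>lam * real k\<bar> * max \<bar>a\<bar> \<bar>b\<bar>" if "g \<in> space \<pi>" for g
    using risk_abs_le[OF that] by (simp add: H_def abs_mult mult_left_mono)
  interpret N: prob_space N
    unfolding N_def by (rule prior.prob_space_gibbs[OF H H_bd])
  have N_sets[simp, measurable_cong]: "sets N = sets \<pi>"
    by (simp add: N_def gibbs_def)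
  have N_space[simp]: "space N = space \<pi>"
    by (rule sets_eq_imp_space_eq) simp
  \<comment> \<open>Since \<open>KL_gibbs\<close> gives a finite value, the definition of
    \<open>KL\<close> must be in its finite branch, which yields all three facts.\<close>
  have KL: "absolutely_continuous \<pi> N" "integrable N (entropy_density (exp 1) \<pi> N)"
    "KL_divergence (exp 1) \<pi> N = - ln (\<integral>g. exp (- H g) \<partial>\<pi>) - (\<integral>g. H g \<partial>N)"
    using prior.KL_gibbs[OF H H_bd] by (auto simp: KL_def N_def split: if_splits)
  interpret pair_prob_space "sample k" N ..
  have int: "integrable (sample k \<Otimes>\<^sub>M N) (\<lambda>(z, g). lam * cumulative_loss k z g)"
    by (rule integrable_const_bound[of _ "\<bar>lam\<bar> * (real k * max \<bar>a\<bar> \<bar>b\<bar>)"])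
      (auto intro!: AE_I2 cumulative_loss_abs_le intro: valid_sample[THEN bspec] simp: space_pair_measure simp del: atLeastAtMost_iff)
  \<comment> \<open>Each coordinate of the product has law \<open>P\<close>, so the \<open>k\<close>
    losses contribute \<open>k\<close> times the risk.\<close>
  have mean: "(\<integral>z. lam * cumulative_loss k z g \<partial>sample k) = H g" if g: "g \<in> space \<pi>" for g
  proof -
    have "integrable (sample k) (\<lambda>z. L (z j) g) \<and> (\<integral>z. L (z j) g \<partial>sample k) = risk P L g"
      if j: "j \<in> {1..k}" for j
    proof -
      have "P = distr (sample k) P (\<lambda>z. z j)"
        using distr_PiM_component[of "{1..k}" "\<lambda>_. P" j, OF data.prob_space_axioms j] by simp
      with integrable_loss[OF g] have "integrable (distr (sample k) P (\<lambda>z. z j)) (\<lambda>y. L y g)"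
        "(\<integral>y. L y g \<partial>distr (sample k) P (\<lambda>z. z j)) = risk P L g"
        by (auto simp: risk_def)
      then show ?thesis
        using g j by (auto simp: integrable_distr_eq integral_distr)
    qed
    then show ?thesis
      by (simp add: cumulative_loss_def H_def)
  qed
  have le: "- log_partition k z \<le> (\<integral>g. lam * cumulative_loss k z g \<partial>N) + KL_divergence (exp 1) \<pi> N"
    if z: "z \<in> space (sample k)" for z
    unfolding log_partition_def
    by (rule prior.ln_integral_exp_le[OF N.prob_space_axioms N_sets KL(1,2) _ cumulative_loss_abs_le])
      (use valid_sample[OF z] in auto)
  have "- (\<integral>z. log_partition k z \<partial>sample k) = (\<integral>z. - log_partition k z \<partial>sample k)"
    by simp
  also have "\<dots> \<le> (\<integral>z. (\<integral>g. lam * cumulative_loss k z g \<partial>N) + KL_divergence (exp 1) \<pi> N \<partial>sample k)"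
    using integrable_fst[OF int] integrable_log_partition le by (intro integral_mono) auto
  also have "\<dots> = (\<integral>z. (\<integral>g. lam * cumulative_loss k z g \<partial>N) \<partial>sample k) + KL_divergence (exp 1) \<pi> N"
    using integrable_fst[OF int] by (simp add: sample.prob_space)
  also have "(\<integral>z. (\<integral>g. lam * cumulative_loss k z g \<partial>N) \<partial>sample k) = (\<integral>g. H g \<partial>N)"
    by (subst Fubini_integral[OF int, symmetric]) (rule Bochner_Integration.integral_cong, simp, rule mean, simp)
  also have "(\<integral>g. H g \<partial>N) + KL_divergence (exp 1) \<pi> N = - ln (\<integral>g. exp (- H g) \<partial>\<pi>)"
    by (simp add: KL)
  finally show ?thesis
    by (simp add: H_def)
qed

text \<open>The one-step bounds telescope from \<open>A 0 = 0\<close>, as the prior has mass 1, to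
  \<open>A (Suc n)\<close>, which \<open>expected_log_partition_ge\<close> controls.\<close>

lemma sum_expected_posterior_risk_le:
  assumes "lam > 0"
  shows "(\<Sum>k\<le>n. \<integral>z. posterior_risk k z \<partial>sample k) / (real n + 1) \<le>
    lam * (b - a)\<^sup>2 / 8 - ln (\<integral>g. exp (- (lam * (real n + 1) * risk P L g)) \<partial>\<pi>) / (lam * (real n + 1))"
proof -
  define A where "A k = (\<integral>z. log_partition k z \<partial>sample k)" for k
  define W where "W = ln (\<integral>g. exp (- (lam * (real n + 1) * risk P L g)) \<partial>\<pi>)"
  have A0: "A 0 = 0"
  proof -
    interpret prob_space "sample 0" by (rule prob_space_sample)
    have "log_partition 0 = (\<lambda>_. 0)"
      by (simp add: log_partition_def fun_eq_iff cumulative_loss_def prior.prob_space)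
    then show ?thesis by (simp add: A_def)
  qed
  \<comment> \<open>The last term tests the posterior of all \<open>n\<close> observations on
    observation \<open>n + 1\<close>, which the algorithm never sees. It exists in the product
    space, whatever \<open>\<Omega>\<close> supports.\<close>
  have "(\<Sum>k\<le>n. \<integral>z. posterior_risk k z \<partial>sample k) \<le> (\<Sum>k\<le>n. lam * (b - a)\<^sup>2 / 8 - (A (Suc k) - A k) / lam)"
    unfolding A_def by (intro sum_mono expected_posterior_risk_le assms)
  also have "\<dots> = (real n + 1) * (lam * (b - a)\<^sup>2 / 8) - A (Suc n) / lam"
    using sum_lessThan_telescope[of A "Suc n"]
    by (simp add: sum_subtractf lessThan_Suc_atMost A0 flip: sum_divide_distrib)
  also have "\<dots> \<le> (real n + 1) * (lam * (b - a)\<^sup>2 / 8) - W / lam"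
    using expected_log_partition_ge[of "Suc n"] assms
    by (simp add: A_def W_def divide_right_mono add.commute)
  finally have "(\<Sum>k\<le>n. \<integral>z. posterior_risk k z \<partial>sample k) / (real n + 1) \<le>
      ((real n + 1) * (lam * (b - a)\<^sup>2 / 8) - W / lam) / (real n + 1)"
    by (intro divide_right_mono) auto
  also have "\<dots> = lam * (b - a)\<^sup>2 / 8 - W / (lam * (real n + 1))"
    by (subst diff_divide_distrib, subst nonzero_mult_div_cancel_left) auto
  finally show ?thesis
    by (simp only: W_def)
qed


section \<open>SeqRand on a fixed sample\<close>

lemma seqrand_score_const: "seqrand_score L (\<lambda>_ _ _. c) z gs k g = cumulative_loss k z g + real k * c"
  by (induction k) (simp_all add: cumulative_loss_def algebra_simps)

text \<open>With constant increments the score exceeds the cumulative loss by an amount free of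
  \<open>g\<close> and of the draws. Hence the \<open>k\<close>-th draw follows
  \<open>posterior k z\<close>, and the mixture formula applies.\<close>

lemma integral_risk_seqrand:
  assumes G: "sets \<pi> = sets G" and z: "valid n z"
  shows "(\<integral>g. risk P L g \<partial>seqrand G L lam (\<lambda>_ _ _. c) (\<lambda>\<rho>. \<rho>) \<pi> n z) = (\<Sum>k\<le>n. posterior_risk k z) / (real n + 1)"
  unfolding posterior_risk_def
proof (rule integral_seqrand[where m = "\<lambda>k. posterior k z"])
  show "posterior k z \<in> space (prob_algebra G)" if "k \<le> n" for k
    using posterior[of k z] z that by (auto simp: space_prob_algebra G)
  show "posterior 0 z = \<pi>"
    by (simp add: posterior_def cumulative_loss_def gibbs_def prior.prob_space density_1)
  show "gibbs \<pi> (\<lambda>g. lam * seqrand_score L (\<lambda>_ _ _. c) z gs (Suc k) g) = posterior (Suc k) z" for k gs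
    using prior.gibbs_add_const[of "\<lambda>g. lam * cumulative_loss (Suc k) z g" "lam * (real (Suc k) * c)"]
    by (simp only: seqrand_score_const posterior_def distrib_left)
  show "risk P L \<in> borel_measurable G"
    using measurable_risk by (simp add: measurable_cong_sets[OF G refl])
  show "\<bar>risk P L g\<bar> \<le> max \<bar>a\<bar> \<bar>b\<bar>" if "g \<in> space G" for g
    using risk_abs_le that sets_eq_imp_space_eq[OF G] by simp
qed

section \<open>Transfer from the product space to the observed sample\<close>

context
  fixes \<Omega> :: "'w measure" and N :: "'z measure" and Z :: "nat \<Rightarrow> 'w \<Rightarrow> 'z" and n :: nat
  assumes \<Omega>: "prob_space \<Omega>" and N: "sets N = sets P"
    and indep: "prob_space.indep_vars \<Omega> (\<lambda>_. N) Z {1..n}"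
    and Z_distr: "\<And>i. i \<in> {1..n} \<Longrightarrow> distr \<Omega> N (Z i) = P"
begin

text \<open>The posterior risk reads only the coordinates \<open>1, ..., k\<close>. By independence
  their joint law is the product measure, so a change of variables suffices.\<close>

lemma posterior_risk_observed:
  assumes "k \<le> n"
  shows "integrable \<Omega> (\<lambda>\<omega>. posterior_risk k (\<lambda>i. Z i \<omega>))"
    and "(\<integral>\<omega>. posterior_risk k (\<lambda>i. Z i \<omega>) \<partial>\<Omega>) = (\<integral>z. posterior_risk k z \<partial>sample k)"
proof -
  interpret \<Omega>: prob_space \<Omega> by (rule \<Omega>)
  let ?X = "\<lambda>\<omega>. \<lambda>i\<in>{1..k}. Z i \<omega>"
  have sub: "{1..k} \<subseteq> {1..n}" using assms by auto
  have ind: "\<Omega>.indep_vars (\<lambda>_. N) Z {1..k}"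
    by (rule \<Omega>.indep_vars_subset[OF indep sub])
  then have Z: "Z i \<in> \<Omega> \<rightarrow>\<^sub>M P" if "i \<in> {1..k}" for i
    using that by (auto simp: \<Omega>.indep_vars_def measurable_cong_sets[OF refl N])
  then have X[measurable]: "?X \<in> \<Omega> \<rightarrow>\<^sub>M sample k"
    by (rule measurable_restrict)
  have distr: "distr \<Omega> (sample k) ?X = sample k"
  \<comment> \<open>The product characterisation of independence is used for a nonempty index set.
    For \<open>k = 0\<close> both sides are probability measures whose only events are the empty set
    and the whole space.\<close>
  proof (cases "k = 0")
    case True
    interpret s: prob_space "sample k" by (rule prob_space_sample)
    interpret d: prob_space "distr \<Omega> (sample k) ?X" by (rule \<Omega>.prob_space_distr) measurable
    show ?thesis
    proof (rule measure_eqI)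
      fix A assume "A \<in> sets (distr \<Omega> (sample k) ?X)"
      then have "A = {} \<or> A = space (sample k)"
        by (simp add: True sets_PiM_empty space_PiM)
      then show "emeasure (distr \<Omega> (sample k) ?X) A = emeasure (sample k) A"
        using s.emeasure_space_1 d.emeasure_space_1 by auto
    qed simp
  next
    case False
    then have "distr \<Omega> (PiM {1..k} (\<lambda>_. N)) ?X = PiM {1..k} (\<lambda>i. distr \<Omega> N (Z i))"
      using ind by (subst \<Omega>.indep_vars_iff_distr_eq_PiM'[symmetric]) (auto simp: \<Omega>.indep_vars_def)
    also have "\<dots> = sample k"
      using sub by (intro PiM_cong) (auto simp: Z_distr)
    also have "distr \<Omega> (PiM {1..k} (\<lambda>_. N)) ?X = distr \<Omega> (sample k) ?X"
      by (intro distr_cong sets_PiM_cong refl) (simp add: N)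
    finally show ?thesis .
  qed
  have cut: "posterior_risk k (\<lambda>i. Z i \<omega>) = posterior_risk k (?X \<omega>)" for \<omega>
    unfolding posterior_risk_def posterior_def cumulative_loss_def by simp
  show "integrable \<Omega> (\<lambda>\<omega>. posterior_risk k (\<lambda>i. Z i \<omega>))"
    unfolding cut using integrable_posterior_risk[of k]
    by (subst (asm) distr[symmetric]) (simp add: integrable_distr_eq)
  show "(\<integral>\<omega>. posterior_risk k (\<lambda>i. Z i \<omega>) \<partial>\<Omega>) = (\<integral>z. posterior_risk k z \<partial>sample k)"
    unfolding cut using integral_distr[OF X measurable_posterior_risk] by (simp add: distr)
qed

lemma expected_seqrand_risk:
  assumes G: "sets \<pi> = sets G"
  shows "(\<integral>\<omega>. (\<integral>g. risk P L g \<partial>seqrand G L lam (\<lambda>_ _ _. c) (\<lambda>\<rho>. \<rho>) \<pi> n (\<lambda>i. Z i \<omega>)) \<partial>\<Omega>)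
    = (\<Sum>k\<le>n. \<integral>z. posterior_risk k z \<partial>sample k) / (real n + 1)"
proof -
  interpret \<Omega>: prob_space \<Omega> by (rule \<Omega>)
  have Z: "Z i \<in> \<Omega> \<rightarrow>\<^sub>M P" if "i \<in> {1..n}" for i
    using that indep by (auto simp: \<Omega>.indep_vars_def measurable_cong_sets[OF refl N])
  have "(\<integral>\<omega>. (\<integral>g. risk P L g \<partial>seqrand G L lam (\<lambda>_ _ _. c) (\<lambda>\<rho>. \<rho>) \<pi> n (\<lambda>i. Z i \<omega>)) \<partial>\<Omega>)
      = (\<integral>\<omega>. (\<Sum>k\<le>n. posterior_risk k (\<lambda>i. Z i \<omega>)) / (real n + 1) \<partial>\<Omega>)"
    by (intro Bochner_Integration.integral_cong refl integral_risk_seqrand G ballI measurable_space[OF Z])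
  then show ?thesis
    using posterior_risk_observed by (simp add: Bochner_Integration.integral_sum)
qed

end

section \<open>Minimum over all randomising distributions\<close>

lemma seqrand_oracle_bound:
  fixes n :: nat
  assumes "lam > 0" and G: "sets \<pi> = sets G"
  defines "bound \<equiv> (\<lambda>\<rho>. ereal (\<integral>g. risk P L g \<partial>\<rho>) + ereal (lam * (b - a)\<^sup>2 / 8)
      + KL \<rho> \<pi> / ereal (lam * (real n + 1)))"
    and "\<rho>' \<equiv> gibbs \<pi> (\<lambda>g. lam * (real n + 1) * risk P L g)"
  shows "is_arg_min bound (\<lambda>\<rho>. \<rho> \<in> space (prob_algebra G)) \<rho>'"
    and "ereal (lam * (b - a)\<^sup>2 / 8 -
      ln (\<integral>g. exp (- (lam * (real n + 1) * risk P L g)) \<partial>\<pi>) / (lam * (real n + 1))) = bound \<rho>'"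
proof -
  define t where "t = lam * (real n + 1)"
  have t: "t > 0" using \<open>lam > 0\<close> by (simp add: t_def)
  define W where "W = ln (\<integral>g. exp (- (t * risk P L g)) \<partial>\<pi>)"
  have bd: "\<bar>t * risk P L g\<bar> \<le> t * max \<bar>a\<bar> \<bar>b\<bar>" if "g \<in> space \<pi>" for g
    using risk_abs_le[OF that] t by (simp add: abs_mult)
  have "KL \<rho>' \<pi> = ereal (- W - t * (\<integral>g. risk P L g \<partial>\<rho>'))"
    using prior.KL_gibbs[of "\<lambda>g. t * risk P L g", OF _ bd] by (simp add: \<rho>'_def t_def W_def)
  \<comment> \<open>After division by \<open>t\<close> the risk term inside the divergence cancels
    the first summand of \<open>bound\<close>.\<close>
  then have eq: "bound \<rho>' = ereal (lam * (b - a)\<^sup>2 / 8 - W / t)"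
    unfolding bound_def t_def[symmetric] using t by (simp add: diff_divide_distrib)
  then show "ereal (lam * (b - a)\<^sup>2 / 8 -
      ln (\<integral>g. exp (- (lam * (real n + 1) * risk P L g)) \<partial>\<pi>) / (lam * (real n + 1))) = bound \<rho>'"
    by (simp add: W_def t_def)
  have "bound \<rho>' \<le> bound \<rho>" if "\<rho> \<in> space (prob_algebra G)" for \<rho>
  proof (cases "absolutely_continuous \<pi> \<rho> \<and> integrable \<rho> (entropy_density (exp 1) \<pi> \<rho>)")
    case True
    \<comment> \<open>The variational inequality for \<open>t\<close> times the risk; divided by
      \<open>t\<close> it compares any competitor of finite divergence with
      \<open>\<rho>'\<close>.\<close>
    have "- W \<le> (\<integral>g. t * risk P L g \<partial>\<rho>) + KL_divergence (exp 1) \<pi> \<rho>"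
      unfolding W_def
      by (rule prior.ln_integral_exp_le[OF _ _ _ _ _ bd]) (use True that G in \<open>auto simp: space_prob_algebra\<close>)
    then have "- W / t \<le> ((\<integral>g. t * risk P L g \<partial>\<rho>) + KL_divergence (exp 1) \<pi> \<rho>) / t"
      using t by (intro divide_right_mono) auto
    then show ?thesis
      unfolding eq using True t by (simp add: bound_def KL_def add_divide_distrib flip: t_def)
  next
    case False
    then have "KL \<rho> \<pi> = \<infinity>"
      unfolding KL_def by (simp only: if_False)
    then show ?thesis
      using t by (simp add: bound_def flip: t_def)
  qed
  moreover have "\<rho>' \<in> space (prob_algebra G)"
    using prior.prob_space_gibbs[of "\<lambda>g. t * risk P L g", OF _ bd]
    by (simp add: \<rho>'_def t_def space_prob_algebra gibbs_def G)
  ultimately show "is_arg_min bound (\<lambda>\<rho>. \<rho> \<in> space (prob_algebra G)) \<rho>'"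
    by (auto simp: is_arg_min_def not_less)
qed

end

section \<open>Uniform priors on finite spaces, and the theorem\<close>

lemma uniform_on_prob_algebra:
  assumes "finite (space G)" "space G \<noteq> {}"
  shows "uniform_on G \<in> space (prob_algebra G)"
proof -
  interpret prob_space "uniform_count_measure (space G)"
    by (rule prob_space_uniform_count_measure[OF assms])
  have "(\<lambda>g. g) \<in> uniform_count_measure (space G) \<rightarrow>\<^sub>M G"
    by (auto simp: measurable_def space_uniform_count_measure sets_uniform_count_measure)
  then show ?thesis
    unfolding uniform_on_def by (simp add: space_prob_algebra prob_space_distr)
qed

lemma integral_uniform_on:
  fixes f :: "'g \<Rightarrow> real"
  assumes "finite (space G)" and "f \<in> borel_measurable G"
  shows "(\<integral>g. f g \<partial>uniform_on G) = (\<Sum>g\<in>space G. f g) / card (space G)"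
proof -
  have "(\<lambda>g. g) \<in> uniform_count_measure (space G) \<rightarrow>\<^sub>M G"
    by (auto simp: measurable_def space_uniform_count_measure sets_uniform_count_measure)
  with assms show ?thesis
    by (simp add: uniform_on_def integral_distr integral_uniform_count_measure)
qed

text \<open>This \<open>t\<close> balances the two summands: with
  \<open>s = sqrt (l / (2 * m))\<close> one has \<open>t = 4 * s / D\<close>, and both summands
  equal \<open>D * s / 2\<close>.\<close>

lemma optimal_temperature:
  fixes l D m :: real
  assumes "l > 0" "D > 0" "m > 0"
  defines "t \<equiv> sqrt (8 * l / (D\<^sup>2 * m))"
  shows "t * D\<^sup>2 / 8 + l / (t * m) = D * sqrt (l / (2 * m))"
proof -
  define s where "s = sqrt (l / (2 * m))"
  have "s > 0" using assms by (simp add: s_def)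
  have "s\<^sup>2 = l / (2 * m)"
    using assms by (simp add: s_def)
  then have l: "l = 2 * m * s\<^sup>2"
    using assms by (simp add: field_simps)
  have "8 * l / (D\<^sup>2 * m) = (4 * s / D)\<^sup>2"
    using assms by (simp add: l field_simps power2_eq_square)
  then have t: "t = 4 * s / D"
    using \<open>s > 0\<close> \<open>D > 0\<close> by (simp add: t_def real_sqrt_unique)
  then show ?thesis
    using \<open>s > 0\<close> \<open>D > 0\<close> \<open>m > 0\<close> unfolding s_def[symmetric] t by (simp add: l field_simps power2_eq_square)
qed

text \<open>The minimum is expressed through a minimiser \<open>\<rho>'\<close>, so that its
  attainment is part of the claim. The bound is extended-valued because the divergence may be
  infinite.\<close>

theorem theorem6p4:
  fixes MX :: "'x measure" and MY :: "'y measure" and G :: "('x \<Rightarrow> 'y) measure"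
    and P :: "('x \<times> 'y) measure" and L :: "'x \<times> 'y \<Rightarrow> ('x \<Rightarrow> 'y) \<Rightarrow> real" and a b :: real
    and \<Omega> :: "'w measure" and Z :: "nat \<Rightarrow> 'w \<Rightarrow> 'x \<times> 'y" and n :: nat
  assumes G: "space G \<subseteq> MX \<rightarrow>\<^sub>M MY"
    and P: "P \<in> space (prob_algebra (MX \<Otimes>\<^sub>M MY))"
    and L_measurable: "(\<lambda>(z, g). L z g) \<in> borel_measurable ((MX \<Otimes>\<^sub>M MY) \<Otimes>\<^sub>M G)"
    and L_bounded: "\<And>z g. z \<in> space (MX \<Otimes>\<^sub>M MY) \<Longrightarrow> g \<in> space G \<Longrightarrow> a \<le> L z g \<and> L z g \<le> b"
    and \<Omega>: "prob_space \<Omega>"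
    and Z_indep: "prob_space.indep_vars \<Omega> (\<lambda>_. MX \<Otimes>\<^sub>M MY) Z {1..n}"
    and Z_distr: "\<And>i. i \<in> {1..n} \<Longrightarrow> distr \<Omega> (MX \<Otimes>\<^sub>M MY) (Z i) = P"
  shows "(\<forall>lam>0. \<forall>\<pi>\<in>space (prob_algebra G).
      let \<mu> = seqrand G L lam (\<lambda>_ _ _. lam * (b - a)\<^sup>2 / 8) (\<lambda>\<rho>. \<rho>) \<pi> n;
          bound = (\<lambda>\<rho>. ereal (\<integral>g. risk P L g \<partial>\<rho>) + ereal (lam * (b - a)\<^sup>2 / 8)
                     + KL \<rho> \<pi> / ereal (lam * (real n + 1)))
      in \<exists>\<rho>'. is_arg_min bound (\<lambda>\<rho>. \<rho> \<in> space (prob_algebra G)) \<rho>' \<and>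
           ereal (\<integral>\<omega>. (\<integral>g. risk P L g \<partial>\<mu> (\<lambda>i. Z i \<omega>)) \<partial>\<Omega>) \<le> bound \<rho>')
    \<and> (finite (space G) \<and> space G \<noteq> {} \<longrightarrow>
      (let lam = sqrt (8 * ln (real (card (space G))) / ((b - a)\<^sup>2 * (real n + 1)));
           \<mu> = seqrand G L lam (\<lambda>_ _ _. lam * (b - a)\<^sup>2 / 8) (\<lambda>\<rho>. \<rho>) (uniform_on G) n
       in (\<integral>\<omega>. (\<integral>g. risk P L g \<partial>\<mu> (\<lambda>i. Z i \<omega>)) \<partial>\<Omega>) - Min (risk P L ` space G)
          \<le> (b - a) * sqrt (ln (real (card (space G))) / (2 * (real n + 1)))))"
proof -
  let ?N = "MX \<Otimes>\<^sub>M MY"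
  interpret P: prob_space P using P by (simp add: space_prob_algebra)
  have P_sets: "sets ?N = sets P" using P by (simp add: space_prob_algebra)
  have loss: "bounded_loss P \<pi> L a b" if "\<pi> \<in> space (prob_algebra G)" for \<pi>
  proof -
    have \<pi>: "prob_space \<pi>" "sets \<pi> = sets G"
      using that by (auto simp: space_prob_algebra)
    interpret \<pi>: prob_space \<pi> by fact
    show ?thesis
    proof
      show "(\<lambda>(z, g). L z g) \<in> borel_measurable (P \<Otimes>\<^sub>M \<pi>)"
        using L_measurable
        by (subst measurable_cong_sets[OF sets_pair_measure_cong[OF P_sets[symmetric] \<pi>(2)] refl])
      show "a \<le> L z g \<and> L z g \<le> b" if "z \<in> space P" "g \<in> space \<pi>" for z g
        using L_bounded[of z g] that sets_eq_imp_space_eq[OF P_sets] sets_eq_imp_space_eq[OF \<pi>(2)] by simp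
    qed
  qed
  \<comment> \<open>Common source of both claims, with the minimum in closed form. The increment
    \<open>c\<close> is arbitrary because it does not affect the draws.\<close>
  have sharp: "(\<integral>\<omega>. (\<integral>g. risk P L g \<partial>seqrand G L lam (\<lambda>_ _ _. c) (\<lambda>\<rho>. \<rho>) \<pi> n (\<lambda>i. Z i \<omega>)) \<partial>\<Omega>)
      \<le> lam * (b - a)\<^sup>2 / 8 -
        ln (\<integral>g. exp (- (lam * (real n + 1) * risk P L g)) \<partial>\<pi>) / (lam * (real n + 1))"
    if "lam > 0" and \<pi>: "\<pi> \<in> space (prob_algebra G)" for lam c \<pi>
  proof -
    interpret bounded_loss P \<pi> L a b lam by (rule loss[OF \<pi>])
    have "sets \<pi> = sets G" using \<pi> by (simp add: space_prob_algebra)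
    from expected_seqrand_risk[OF \<Omega> P_sets Z_indep Z_distr this] sum_expected_posterior_risk_le[OF \<open>lam > 0\<close>, of n]
    show ?thesis by simp
  qed
  show ?thesis
  proof (intro conjI allI impI ballI)
    fix lam :: real and \<pi> assume lam: "lam > 0" and \<pi>: "\<pi> \<in> space (prob_algebra G)"
    interpret bounded_loss P \<pi> L a b lam by (rule loss[OF \<pi>])
    have G_sets: "sets \<pi> = sets G" using \<pi> by (simp add: space_prob_algebra)
    show "let \<mu> = seqrand G L lam (\<lambda>_ _ _. lam * (b - a)\<^sup>2 / 8) (\<lambda>\<rho>. \<rho>) \<pi> n;
          bound = (\<lambda>\<rho>. ereal (\<integral>g. risk P L g \<partial>\<rho>) + ereal (lam * (b - a)\<^sup>2 / 8)
                     + KL \<rho> \<pi> / ereal (lam * (real n + 1)))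
      in \<exists>\<rho>'. is_arg_min bound (\<lambda>\<rho>. \<rho> \<in> space (prob_algebra G)) \<rho>' \<and>
           ereal (\<integral>\<omega>. (\<integral>g. risk P L g \<partial>\<mu> (\<lambda>i. Z i \<omega>)) \<partial>\<Omega>) \<le> bound \<rho>'"
      unfolding Let_def
      \<comment> \<open>The witness, found by unification, is the Gibbs measure of
        \<open>lam * (n + 1)\<close> times the risk.\<close>
      by (intro exI conjI, rule seqrand_oracle_bound(1)[OF lam G_sets],
          rule ord_le_eq_trans[OF _ seqrand_oracle_bound(2)[OF lam G_sets]])
        (use sharp[OF lam \<pi>] in simp)
  next
    assume fin: "finite (space G) \<and> space G \<noteq> {}"
    define R where "R = Min (risk P L ` space G)"
    define lam where "lam = sqrt (8 * ln (real (card (space G))) / ((b - a)\<^sup>2 * (real n + 1)))"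
    define c where "c = lam * (b - a)\<^sup>2 / 8"
    let ?U = "uniform_on G"
    let ?E = "\<integral>\<omega>. (\<integral>g. risk P L g \<partial>seqrand G L lam (\<lambda>_ _ _. c) (\<lambda>\<rho>. \<rho>) ?U n (\<lambda>i. Z i \<omega>)) \<partial>\<Omega>"
    have U: "?U \<in> space (prob_algebra G)"
      using fin by (intro uniform_on_prob_algebra) auto
    then interpret bounded_loss P ?U L a b lam by (rule loss)
    have G_sets: "sets ?U = sets G" using U by (simp add: space_prob_algebra)
    have G_space: "space ?U = space G" by (rule sets_eq_imp_space_eq[OF G_sets])
    have risk_in: "a \<le> risk P L g \<and> risk P L g \<le> b" if "g \<in> space G" for g
      using risk_bounded that G_space by simp
    then have "a \<le> b" using fin by fastforce
    have "R \<in> risk P L ` space G"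
      unfolding R_def using fin by (intro Min_in) auto
    then obtain g0 where g0: "g0 \<in> space G" "risk P L g0 = R" by auto
    have "card (space G) > 0"
      using fin by (simp add: card_gt_0_iff)
    then have card: "card (space G) \<ge> 1"
      by linarith
    have "?E - R \<le> (b - a) * sqrt (ln (real (card (space G))) / (2 * (real n + 1)))"
    \<comment> \<open>In these degenerate cases \<open>lam\<close> is 0, by \<open>ln 1 = 0\<close>
      or by division by zero, so \<open>sharp\<close> does not apply. But then the risk is constant
      on \<open>G\<close>, and every draw attains the minimum.\<close>
    proof (cases "card (space G) = 1 \<or> a = b")
      case True
      have R: "risk P L g = R" if "g \<in> space G" for g
        using True
      proof
        assume "card (space G) = 1"
        then obtain x where "space G = {x}" by (rule card_1_singletonE)
        then show ?thesis
          using that g0 by auto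
      next
        assume "a = b"
        then show ?thesis
          using risk_in[OF that] risk_in[OF g0(1)] g0(2) by simp
      qed
      have post_R: "posterior_risk k z = R" if "valid k z" for k z
      proof -
        interpret prob_space "posterior k z" by (rule posterior[OF that])
        have "posterior_risk k z = (\<integral>g. R \<partial>posterior k z)"
          unfolding posterior_risk_def by (rule Bochner_Integration.integral_cong) (auto simp: R G_space)
        then show ?thesis using prob_space by simp
      qed
      have "(\<integral>z. posterior_risk k z \<partial>sample k) = (\<integral>z. R \<partial>sample k)" for k
        by (rule Bochner_Integration.integral_cong[OF refl post_R[OF valid_sample]])
      then have "(\<integral>z. posterior_risk k z \<partial>sample k) = R" for k
        by (simp add: prob_space.prob_space[OF prob_space_sample])
      moreover have "(1 + real n) * R / (real n + 1) = R"
        by (simp add: field_simps)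
      ultimately have "?E = R"
        using expected_seqrand_risk[OF \<Omega> P_sets Z_indep Z_distr G_sets, of c] by simp
      then show ?thesis
        using \<open>a \<le> b\<close> card by simp
    next
      case False
      then have D: "b - a > 0" and l: "ln (real (card (space G))) > 0"
        using \<open>a \<le> b\<close> card by auto
      then have lam: "lam > 0"
        by (simp add: lam_def)
      define t where "t = lam * (real n + 1)"
      have t: "t > 0" using lam by (simp add: t_def)
      \<comment> \<open>Keeping only the term of a best \<open>g0\<close> in the uniform average
        costs \<open>ln (card (space G))\<close>, the usual divergence of a point mass. Arguing with
        the sum avoids assuming that singletons are measurable.\<close>
      have "exp (- (t * R)) \<le> (\<Sum>g\<in>space G. exp (- (t * risk P L g)))"
        using member_le_sum[of g0 "space G" "\<lambda>g. exp (- (t * risk P L g))"] g0 fin by simp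
      then have "exp (- (t * R)) / card (space G) \<le> (\<Sum>g\<in>space G. exp (- (t * risk P L g))) / card (space G)"
        by (rule divide_right_mono) simp
      also have "\<dots> = (\<integral>g. exp (- (t * risk P L g)) \<partial>?U)"
        using fin measurable_risk
        by (subst integral_uniform_on) (auto simp: measurable_cong_sets[OF G_sets refl])
      finally have "ln (exp (- (t * R)) / card (space G)) \<le> ln (\<integral>g. exp (- (t * risk P L g)) \<partial>?U)"
        using card by (intro ln_mono) auto
      then have "- (t * R) - ln (card (space G)) \<le> ln (\<integral>g. exp (- (t * risk P L g)) \<partial>?U)"
        using card by (simp add: ln_divide_pos)
      then have "(- (t * R) - ln (card (space G))) / t \<le> ln (\<integral>g. exp (- (t * risk P L g)) \<partial>?U) / t"
        using t by (intro divide_right_mono) auto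
      then have "?E - R \<le> c + ln (card (space G)) / t"
        using sharp[OF lam U, of c] t by (simp add: t_def[symmetric] c_def diff_divide_distrib)
      also have "\<dots> = (b - a) * sqrt (ln (real (card (space G))) / (2 * (real n + 1)))"
        using optimal_temperature[OF l D, of "real n + 1"] by (simp add: c_def t_def lam_def)
      finally show ?thesis .
    qed
    then show "let lam = sqrt (8 * ln (real (card (space G))) / ((b - a)\<^sup>2 * (real n + 1)));
           \<mu> = seqrand G L lam (\<lambda>_ _ _. lam * (b - a)\<^sup>2 / 8) (\<lambda>\<rho>. \<rho>) (uniform_on G) n
       in (\<integral>\<omega>. (\<integral>g. risk P L g \<partial>\<mu> (\<lambda>i. Z i \<omega>)) \<partial>\<Omega>) - Min (risk P L ` space G)
          \<le> (b - a) * sqrt (ln (real (card (space G))) / (2 * (real n + 1)))"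
      by (simp add: Let_def R_def c_def lam_def)
  qed
qed

end
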